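(* Let $D=(E,\mathcal{F})$ be a binary delta-matroid. Then its twist polynomial ${}^\partial w_D(z)=\sum_{A\subseteq E} z^{w(D*A)}$ is either an even polynomial, an odd polynomial, or both even-interpolating and odd-interpolating.
   Context: A set system is a pair $D=(E,\mathcal{F})$ with $E$ a finite set and $\mathcal{F}$ a collection of subsets of $E$ (feasible sets). A delta-matroid is a set system with $\mathcal{F}\neq\emptyset$ satisfying the Symmetric Exchange Axiom: for all $X,Y\in\mathcal{F}$ and $u\in X\Delta Y$ there is $v\in X\Delta Y$ (possibly $v=u$) with $X\Delta\{u,v\}\in\mathcal{F}$, where $\Delta$ is symmetric difference. The twist of $D$ by $A\subseteq E$ is $D*A=(E,\{A\Delta X: X\in\mathcal{F}\})$. For a symmetric matrix $C$ over $\mathrm{GF}(2)$ with rows and columns indexed by $E$, $D(C)=(E,\{A\subseteq E: C[A]\text{ non-singular}\})$, where $C[A]$ is the principal submatrix on $A$ and $C[\emptyset]$ is regarded as non-singular. A delta-matroid is binary if some twist of it is isomorphic to $D(C)$ for some such $C$. The width of a set system is $w(D)=\max\{|F|:F\in\mathcal{F}\}-\min\{|F|:F\in\mathcal{F}\}$. For a polynomial $p(z)=\sum_i c_iz^i$, $p$ has a gap of size $k$ at $c_i$ if $c_{i-1}c_{i+k}\neq0$ and $c_i=\dots=c_{i+k-1}=0$; $p$ is interpolating if it is nonzero and has no gaps. Writing $p(z)=p_e(z^2)+z\,p_o(z^2)$ with $p_e(z^2)$ the even-degree terms and $z\,p_o(z^2)$ the odd-degree terms, $p$ is even-interpolating (resp.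 odd-interpolating) if $p_e(z^2)$ (resp. $p_o(z^2)$) is interpolating. An even (resp. odd) polynomial is one whose only nonzero terms have even (resp. odd) degree. *)

theory Defs
  imports "HOL-Library.Z2" "HOL-Combinatorics.Permutations" "HOL-Computational_Algebra.Polynomial"
begin

type_synonym 'a set_system = "'a set \<times> 'a set set"

definition ground :: "'a set_system \<Rightarrow> 'a set" where "ground D = fst D"
definition feasible :: "'a set_system \<Rightarrow> 'a set set" where "feasible D = snd D"

definition set_system :: "'a set_system \<Rightarrow> bool" where
  "set_system D \<longleftrightarrow> finite (ground D) \<and> (\<forall>X\<in>feasible D. X \<subseteq> ground D)"

definition delta_matroid :: "'a set_system \<Rightarrow> bool" where
  "delta_matroid D \<longleftrightarrow> set_system D \<and> feasible D \<noteq> {} \<and>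
     (\<forall>X\<in>feasible D. \<forall>Y\<in>feasible D. \<forall>u\<in>sym_diff X Y.
        \<exists>v\<in>sym_diff X Y. sym_diff X {u, v} \<in> feasible D)"

definition twist :: "'a set_system \<Rightarrow> 'a set \<Rightarrow> 'a set_system" where
  "twist D A = (ground D, (\<lambda>X. sym_diff A X) ` feasible D)"

definition det_GF2 :: "('a \<Rightarrow> 'a \<Rightarrow> bit) \<Rightarrow> 'a set \<Rightarrow> bit" where
  "det_GF2 C A = (\<Sum>p\<in>{p. p permutes A}. of_int (sign p) * (\<Prod>i\<in>A. C i (p i)))"

(* D(C) for a symmetric GF(2) matrix indexed by E; C[{}] is non-singular since det = 1 *)
definition DC :: "'a set \<Rightarrow> ('a \<Rightarrow> 'a \<Rightarrow> bit) \<Rightarrow> 'a set_system" where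
  "DC E C = (E, {A. A \<subseteq> E \<and> det_GF2 C A \<noteq> 0})"

definition symmetric_on :: "'a set \<Rightarrow> ('a \<Rightarrow> 'a \<Rightarrow> bit) \<Rightarrow> bool" where
  "symmetric_on E C \<longleftrightarrow> (\<forall>i\<in>E. \<forall>j\<in>E. C i j = C j i)"

definition iso_set_system :: "'a set_system \<Rightarrow> 'a set_system \<Rightarrow> bool" where
  "iso_set_system D D' \<longleftrightarrow> (\<exists>f. bij_betw f (ground D) (ground D') \<and>
       (\<lambda>X. f ` X) ` feasible D = feasible D')"

definition binary_delta_matroid :: "'a set_system \<Rightarrow> bool" where
  "binary_delta_matroid D \<longleftrightarrow> delta_matroid D \<and>
     (\<exists>A\<subseteq>ground D. \<exists>E' C. finite E' \<and> symmetric_on E' C \<and>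
        iso_set_system (twist D A) (DC E' C))"

definition width :: "'a set_system \<Rightarrow> nat" where
  "width D = Max (card ` feasible D) - Min (card ` feasible D)"

definition twist_poly :: "'a set_system \<Rightarrow> int poly" where
  "twist_poly D = (\<Sum>A\<in>Pow (ground D). monom 1 (width (twist D A)))"

definition has_gap :: "'b::zero poly \<Rightarrow> nat \<Rightarrow> nat \<Rightarrow> bool" where
  "has_gap p i k \<longleftrightarrow> 1 \<le> i \<and> 1 \<le> k \<and> coeff p (i - 1) \<noteq> 0 \<and> coeff p (i + k) \<noteq> 0 \<and>
     (\<forall>j. i \<le> j \<and> j < i + k \<longrightarrow> coeff p j = 0)"

definition interpolating :: "'b::zero poly \<Rightarrow> bool" where
  "interpolating p \<longleftrightarrow> p \<noteq> 0 \<and> \<not> (\<exists>i k. has_gap p i k)"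

(* p(z) = p_e(z^2) + z p_o(z^2) *)
definition even_part :: "'b::comm_semiring_1 poly \<Rightarrow> 'b poly" where
  "even_part p = (\<Sum>i\<le>degree p. monom (coeff p (2 * i)) i)"

definition odd_part :: "'b::comm_semiring_1 poly \<Rightarrow> 'b poly" where
  "odd_part p = (\<Sum>i\<le>degree p. monom (coeff p (2 * i + 1)) i)"

definition even_interpolating :: "'b::comm_semiring_1 poly \<Rightarrow> bool" where
  "even_interpolating p \<longleftrightarrow> interpolating (even_part p)"

definition odd_interpolating :: "'b::comm_semiring_1 poly \<Rightarrow> bool" where
  "odd_interpolating p \<longleftrightarrow> interpolating (odd_part p)"

definition even_poly :: "'b::zero poly \<Rightarrow> bool" where
  "even_poly p \<longleftrightarrow> (\<forall>i. coeff p i \<noteq> 0 \<longrightarrow> even i)"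

definition odd_poly :: "'b::zero poly \<Rightarrow> bool" where
  "odd_poly p \<longleftrightarrow> (\<forall>i. coeff p i \<noteq> 0 \<longrightarrow> odd i)"

end

theory Submission
  imports Defs "Jordan_Normal_Form.Determinant"
begin

text \<open>Up to isomorphism and twisting, \<open>D = D(C)\<close>, and the width of the twist by \<open>A\<close> is the rank
  of the symmetric matrix \<open>M A = C[A] \<oplus> C[E - A]\<close>, in other words \<open>card E\<close> minus the nullities of the
  two blocks. Its diagonal \<open>d\<close> does not depend on \<open>A\<close>, and its rank has the parity of \<open>d \<bullet> u\<close>
  for every \<open>u\<close> with \<open>M A u = d\<close>. Moving one element \<open>t\<close> across the partition changes the rank
  by at most 2, and when the rank drops by exactly 2 every such \<open>u\<close> for the old matrix still solves
  the equation for the new one.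

  Suppose that the value \<open>k\<close> is skipped, that \<open>A\<close> has width less than \<open>k\<close> and of the same parity
  as \<open>k\<close>, and choose \<open>B\<close> of width greater than \<open>k\<close> as close to \<open>A\<close> as possible. Every single step
  from \<open>B\<close> towards \<open>A\<close> then has to jump from \<open>k + 1\<close> to \<open>k - 1\<close>. The changes of the matrix
  add up over the moved elements, so a solution for \<open>B\<close> is also one for \<open>A\<close>, and the width of \<open>A\<close> has the
  parity of \<open>k + 1\<close>, a contradiction.\<close>

section \<open>Arithmetic and determinants over GF(2)\<close>

text \<open>These default rules turn ring operations on \<open>bit\<close> into bitwise ones, which
  would put distributivity and sum manipulation out of reach of the simplifier.\<close>

declare add_bit_eq_xor [simp del] mult_bit_eq_and [simp del]

lemma bit_add_self [simp]: "a + a = (0::bit)"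
  by (cases a) simp_all

lemma bit_add_eq_0_iff: "a + b = 0 \<longleftrightarrow> a = (b::bit)"
  by (cases a; cases b) simp_all

lemma of_int_sign_bit: "of_int (sign p) = (1::bit)"
  by (simp add: sign_def)

text \<open>Since -1 = 1 in GF(2), the signs disappear and the determinant is the permanent.\<close>

lemma det_GF2_eq_sum: "det_GF2 C A = (\<Sum>p | p permutes A. \<Prod>i\<in>A. C i (p i))"
  unfolding det_GF2_def by (simp add: of_int_sign_bit)

lemma det_GF2_image:
  assumes "bij_betw f A B"
  shows "det_GF2 C B = det_GF2 (\<lambda>i j. C (f i) (f j)) A"
proof -
  define g where "g = inv_into A f"
  have gf: "g (f i) = i" "f i \<in> B" if "i \<in> A" for i
    using assms that by (auto simp: g_def bij_betw_inv_into_left bij_betw_def)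
  have "det_GF2 (\<lambda>i j. C (f i) (f j)) A
      = (\<Sum>p | p permutes A. \<Prod>i\<in>B. C i (if i \<in> B then f (p (g i)) else i))"
    unfolding det_GF2_eq_sum
  proof (intro sum.cong refl)
    fix p
    have "(\<Prod>i\<in>B. C i (if i \<in> B then f (p (g i)) else i))
        = (\<Prod>i\<in>A. C (f i) (if f i \<in> B then f (p (g (f i))) else f i))"
      by (rule prod.reindex_bij_betw[OF assms, symmetric])
    also have "\<dots> = (\<Prod>i\<in>A. C (f i) (f (p i)))"
      by (intro prod.cong) (auto simp: gf)
    finally show "(\<Prod>i\<in>A. C (f i) (f (p i)))
        = (\<Prod>i\<in>B. C i (if i \<in> B then f (p (g i)) else i))" by simp
  qed
  also have "\<dots> = det_GF2 C B"
    unfolding det_GF2_eq_sum g_def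
    by (rule sum.reindex_bij_betw[OF bij_betw_permutations[OF assms]])
  finally show ?thesis by simp
qed

text \<open>The set \<open>A\<close> is numbered so that the kernel criterion for field matrices
  applies. Vectors on \<open>A\<close> are functions on the whole type that are 0 outside
  \<open>A\<close>, so being non-zero as a function means being non-zero on
  \<open>A\<close>.\<close>

lemma det_GF2_eq_0_iff:
  fixes C :: "'a \<Rightarrow> 'a \<Rightarrow> bit"
  assumes "finite A"
  shows "det_GF2 C A = 0 \<longleftrightarrow>
    (\<exists>x. (\<forall>i. i \<notin> A \<longrightarrow> x i = 0) \<and> x \<noteq> (\<lambda>_. 0) \<and> (\<forall>i\<in>A. (\<Sum>j\<in>A. C i j * x j) = 0))"
    (is "_ \<longleftrightarrow> (\<exists>x. ?P x)")
proof -
  define n where "n = card A"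
  obtain f where f: "bij_betw f {0..<n} A"
    using ex_bij_betw_nat_finite[OF assms] n_def by blast
  define g where "g = inv_into {0..<n} f"
  have gf: "g (f i) = i" if "i < n" for i
    using f that by (simp add: g_def bij_betw_inv_into_left)
  have fg: "f (g i) = i" "g i < n" if "i \<in> A" for i
    using f that bij_betw_inv_into_right[OF f that] bij_betwE[OF bij_betw_inv_into[OF f]]
    by (auto simp: g_def)
  have fA: "f i \<in> A" if "i < n" for i
    using f that by (auto simp: bij_betw_def)
  define M where "M = mat n n (\<lambda>(i, j). C (f i) (f j))"
  have M: "M \<in> carrier_mat n n" by (simp add: M_def)
  have reindex: "(\<Sum>j\<in>A. h j) = (\<Sum>j = 0..<n. h (f j))" for h :: "'a \<Rightarrow> bit"
    using sum.reindex_bij_betw[OF f, of h] by simp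
  have "det M = (\<Sum>p | p permutes {0..<n}. \<Prod>i = 0..<n. C (f i) (f (p i)))"
    unfolding det_def'[OF M]
  proof (rule sum.cong[OF refl])
    fix p assume "p \<in> {p. p permutes {0..<n}}"
    then have p: "p i < n" if "i < n" for i
      using that permutes_in_image[of p "{0..<n}" i] by auto
    have "(\<Prod>i = 0..<n. M $$ (i, p i)) = (\<Prod>i = 0..<n. C (f i) (f (p i)))"
      by (intro prod.cong) (auto simp: M_def p)
    then show "signof p * (\<Prod>i = 0..<n. M $$ (i, p i)) = (\<Prod>i = 0..<n. C (f i) (f (p i)))"
      by (simp add: sign_def)
  qed
  then have det: "det M = det_GF2 C A"
    unfolding det_GF2_image[OF f] unfolding det_GF2_eq_sum .
  have mult: "(M *\<^sub>v v) $ i = (\<Sum>j = 0..<n. C (f i) (f j) * v $ j)"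
    if "v \<in> carrier_vec n" "i < n" for v i
    using that by (auto simp: M_def scalar_prod_def intro!: sum.cong)
  have "det M = 0 \<longleftrightarrow> (\<exists>x. ?P x)"
    unfolding det_0_iff_vec_prod_zero_field[OF M]
  proof
    assume "\<exists>v. v \<in> carrier_vec n \<and> v \<noteq> 0\<^sub>v n \<and> M *\<^sub>v v = 0\<^sub>v n"
    then obtain v where v: "v \<in> carrier_vec n" "v \<noteq> 0\<^sub>v n" "M *\<^sub>v v = 0\<^sub>v n" by blast
    define x where "x i = (if i \<in> A then v $ g i else 0)" for i
    have xf: "x (f i) = v $ i" if "i < n" for i
      using that by (simp add: x_def fA gf)
    obtain k where k: "k < n" "v $ k \<noteq> 0"
      using v(1,2) by (metis eq_vecI carrier_vecD index_zero_vec)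
    have "x (f k) \<noteq> 0"
      using k xf by simp
    then have "x \<noteq> (\<lambda>_. 0)" by metis
    moreover have "(\<Sum>j\<in>A. C i j * x j) = 0" if "i \<in> A" for i
    proof -
      have "(\<Sum>j\<in>A. C i j * x j) = (\<Sum>j = 0..<n. C i (f j) * v $ j)"
        unfolding reindex by (intro sum.cong) (auto simp: xf)
      also have "\<dots> = (M *\<^sub>v v) $ g i"
        using mult[OF v(1), of "g i"] fg[OF that] by simp
      finally show ?thesis using v(3) fg[OF that] by simp
    qed
    ultimately show "\<exists>x. ?P x"
      by (intro exI[of _ x]) (auto simp: x_def)
  next
    assume "\<exists>x. ?P x"
    then obtain x where x: "?P x" by blast
    define v where "v = vec n (\<lambda>i. x (f i))"
    have v: "v \<in> carrier_vec n" by (simp add: v_def)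
    obtain i where i: "x i \<noteq> 0" "i \<in> A" using x by (metis ext)
    then have "v $ g i \<noteq> 0 \<and> g i < n" using fg[OF i(2)] by (simp add: v_def)
    then have "v \<noteq> 0\<^sub>v n" by auto
    moreover have "M *\<^sub>v v = 0\<^sub>v n"
    proof (rule eq_vecI)
      fix i assume "i < dim_vec (0\<^sub>v n)"
      then have i: "i < n" by simp
      have "(M *\<^sub>v v) $ i = (\<Sum>j\<in>A. C (f i) j * x j)"
        unfolding reindex mult[OF v i] by (intro sum.cong) (auto simp: v_def)
      then show "(M *\<^sub>v v) $ i = 0\<^sub>v n $ i" using x fA[OF i] i by simp
    qed (simp add: M_def)
    ultimately show "\<exists>v. v \<in> carrier_vec n \<and> v \<noteq> 0\<^sub>v n \<and> M *\<^sub>v v = 0\<^sub>v n"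
      using v by blast
  qed
  with det show ?thesis by simp
qed

section \<open>Counting in finite spaces over GF(2)\<close>

lemma finite_UNIV_bit: "finite (UNIV :: bit set)"
proof -
  have "(UNIV :: bit set) = {0, 1}" by (auto intro: bit.exhaust)
  then show ?thesis by (metis finite.emptyI finite.insertI)
qed

text \<open>Translation by \<open>k\<close> is an involution of \<open>S\<close> that exchanges the
  two fibres of the additive map \<open>h\<close>.\<close>

lemma card_eq_double_kernel:
  fixes S :: "('a \<Rightarrow> bit) set" and h :: "('a \<Rightarrow> bit) \<Rightarrow> bit"
  assumes fin: "finite S" and add: "\<And>x y. x \<in> S \<Longrightarrow> y \<in> S \<Longrightarrow> (\<lambda>i. x i + y i) \<in> S"
    and h: "\<And>x y. h (\<lambda>i. x i + y i) = h x + h y" and k: "k \<in> S" "h k = 1"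
  shows "card S = 2 * card {x \<in> S. h x = 0}"
proof -
  define s where "s x = (\<lambda>i. x i + k i)" for x :: "'a \<Rightarrow> bit"
  have ss: "s (s x) = x" for x by (simp add: s_def add.assoc)
  have sS: "s x \<in> S" if "x \<in> S" for x using add[OF that k(1)] by (simp add: s_def)
  have hs: "h (s x) = h x + 1" for x using h[of x k] k by (simp add: s_def)
  have "bij_betw s {x \<in> S. h x = 0} {x \<in> S. h x = 1}"
    by (rule bij_betw_byWitness[where f' = s]) (auto simp: ss sS hs)
  then have eq: "card {x \<in> S. h x = 0} = card {x \<in> S. h x = 1}"
    by (rule bij_betw_same_card)
  have "S = {x \<in> S. h x = 0} \<union> {x \<in> S. h x = 1}"
    by (auto intro: bit.exhaust)
  then have "card S = card {x \<in> S. h x = 0} + card {x \<in> S. h x = 1}"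
    using fin by (subst \<open>S = _\<close>, intro card_Un_disjoint) auto
  with eq show ?thesis by simp
qed

section \<open>Symmetric matrices over GF(2) and their bilinear form\<close>

locale symmetric_bit_matrix =
  fixes E :: "'a set" and C :: "'a \<Rightarrow> 'a \<Rightarrow> bit"
  assumes finite_E: "finite E" and C_sym: "i \<in> E \<Longrightarrow> j \<in> E \<Longrightarrow> C i j = C j i"
begin

definition mv :: "('a \<Rightarrow> bit) \<Rightarrow> 'a \<Rightarrow> bit" where
  "mv x i = (\<Sum>j\<in>E. C i j * x j)"

definition dot :: "('a \<Rightarrow> bit) \<Rightarrow> ('a \<Rightarrow> bit) \<Rightarrow> bit" where
  "dot x y = (\<Sum>i\<in>E. x i * y i)"

definition diag :: "'a \<Rightarrow> bit" where
  "diag i = C i i"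

text \<open>Extension by zero lets vectors for different index sets live in one type; on the rows in
  \<open>A\<close>, \<open>mv\<close> then acts on \<open>vectors A\<close> as the principal
  submatrix \<open>C[A]\<close>.\<close>

definition vectors :: "'a set \<Rightarrow> ('a \<Rightarrow> bit) set" where
  "vectors A = {x. \<forall>i. i \<notin> A \<longrightarrow> x i = 0}"

definition solves :: "'a set \<Rightarrow> ('a \<Rightarrow> bit) \<Rightarrow> ('a \<Rightarrow> bit) \<Rightarrow> bool" where
  "solves A g x \<longleftrightarrow> x \<in> vectors A \<and> (\<forall>i\<in>A. mv x i = g i)"

definition ker :: "'a set \<Rightarrow> ('a \<Rightarrow> bit) set" where
  "ker A = {x. solves A (\<lambda>_. 0) x}"

definition regular :: "'a set \<Rightarrow> bool" where
  "regular A \<longleftrightarrow> ker A = {\<lambda>_. 0}"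

text \<open>This is the dimension of the kernel of \<open>C[A]\<close>, as \<open>card_ker\<close>
  shows. In this form it is also the least size of a feasible set in the twist by \<open>A\<close>
  of the set system of regular sets.\<close>

definition nul :: "'a set \<Rightarrow> nat" where
  "nul A = Min ((\<lambda>F. card (sym_diff A F)) ` {F. F \<subseteq> E \<and> regular F})"

lemma mv_add: "mv (\<lambda>i. x i + y i) j = mv x j + mv y j"
  by (simp add: mv_def distrib_left sum.distrib)

lemma mv_zero [simp]: "mv (\<lambda>_. 0) = (\<lambda>_. 0)"
  by (simp add: mv_def fun_eq_iff)

lemma mv_upd:
  assumes "t \<in> E" "x t = 0"
  shows "mv (x(t := 1)) i = mv x i + C i t"
proof -
  have "mv (\<lambda>i. if i = t then 1 else 0) i = C i t"
    using assms finite_E by (simp add: mv_def if_distrib sum.delta cong: if_cong)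
  moreover have "x(t := 1) = (\<lambda>i. x i + (if i = t then 1 else 0))"
    using assms by auto
  ultimately show ?thesis using mv_add[of x "\<lambda>i. if i = t then 1 else 0" i] by simp
qed

lemma dot_commute: "dot x y = dot y x"
  by (simp add: dot_def mult.commute)

lemma dot_add: "dot (\<lambda>i. x i + y i) z = dot x z + dot y z"
  by (simp add: dot_def distrib_right sum.distrib)

lemma dot_add_right: "dot z (\<lambda>i. x i + y i) = dot z x + dot z y"
  by (simp add: dot_def distrib_left sum.distrib)

lemma dot_zero [simp]: "dot x (\<lambda>_. 0) = 0"
  by (simp add: dot_def)

lemma dot_mv_commute: "dot x (mv y) = dot y (mv x)"
proof -
  have "dot x (mv y) = (\<Sum>i\<in>E. \<Sum>j\<in>E. x i * (C i j * y j))"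
    by (simp add: dot_def mv_def sum_distrib_left)
  also have "\<dots> = (\<Sum>j\<in>E. \<Sum>i\<in>E. x i * (C i j * y j))"
    by (rule sum.swap)
  also have "\<dots> = (\<Sum>j\<in>E. \<Sum>i\<in>E. y j * (C j i * x i))"
    using C_sym by (intro sum.cong) (auto simp: mult_ac)
  also have "\<dots> = dot y (mv x)"
    by (simp add: dot_def mv_def sum_distrib_left)
  finally show ?thesis .
qed

text \<open>In characteristic 2 the off-diagonal terms of a symmetric form cancel in pairs.\<close>

lemma dot_mv_self: "dot x (mv x) = dot x diag"
proof -
  have "(\<Sum>i\<in>S. \<Sum>j\<in>S. x i * C i j * x j) = (\<Sum>i\<in>S. x i * C i i)"
    if "finite S" "S \<subseteq> E" for S
    using that
  proof (induction S)
    case (insert t S)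
    have "(\<Sum>j\<in>S. x t * C t j * x j) = (\<Sum>i\<in>S. x i * C i t * x t)"
      using insert.prems C_sym by (intro sum.cong) (auto simp: mult_ac)
    moreover have "x t * C t t * x t = x t * C t t"
      by (cases "x t") simp_all
    ultimately show ?case
      using insert by (simp add: sum.distrib add_ac)
  qed simp
  from this[OF finite_E order.refl] show ?thesis
    by (simp add: dot_def mv_def diag_def sum_distrib_left mult.assoc)
qed

lemma dot_mv_solution:
  assumes "x \<in> vectors A" "\<And>i. i \<in> A \<Longrightarrow> mv y i = g i"
  shows "dot x (mv y) = dot x g"
  unfolding dot_def
proof (intro sum.cong refl)
  show "x i * mv y i = x i * g i" for i
    using assms by (cases "i \<in> A") (auto simp: vectors_def)
qed

text \<open>If the equation for \<open>y\<close> is known only on the rows in \<open>A\<close>, the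
  error at row \<open>t\<close> enters weighted by \<open>x t\<close>. Evaluating the symmetric form
  in both orders then yields information about row or coordinate \<open>t\<close>.\<close>

lemma dot_mv_insert:
  assumes "x \<in> vectors (insert t A)" "t \<in> E" "\<And>i. i \<in> A \<Longrightarrow> mv y i = g i"
  shows "dot x (mv y) = dot x g + x t * (mv y t + g t)"
proof -
  have "dot x (mv y) = dot x (g(t := mv y t))"
    using assms(3) by (intro dot_mv_solution[OF assms(1)]) auto
  also have "g(t := mv y t) = (\<lambda>i. g i + (if i = t then mv y t + g t else 0))"
    by (auto simp: fun_eq_iff add.left_commute[of "g t"])
  also have "dot x \<dots> = dot x g + x t * (mv y t + g t)"
    using assms(2) finite_E unfolding dot_add_right
    by (simp add: dot_def if_distrib sum.delta cong: if_cong)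
  finally show ?thesis .
qed

section \<open>Kernels of principal submatrices\<close>

lemma vectors_add: "x \<in> vectors A \<Longrightarrow> y \<in> vectors A \<Longrightarrow> (\<lambda>i. x i + y i) \<in> vectors A"
  by (simp add: vectors_def)

lemma vectors_mono: "x \<in> vectors A \<Longrightarrow> A \<subseteq> B \<Longrightarrow> x \<in> vectors B"
  by (auto simp: vectors_def)

lemma ker_iff: "x \<in> ker A \<longleftrightarrow> x \<in> vectors A \<and> (\<forall>i\<in>A. mv x i = 0)"
  by (simp add: ker_def solves_def)

lemma ker_add: "x \<in> ker A \<Longrightarrow> y \<in> ker A \<Longrightarrow> (\<lambda>i. x i + y i) \<in> ker A"
  by (simp add: ker_iff vectors_add mv_add)

lemma zero_in_ker: "(\<lambda>_. 0) \<in> ker A"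
  by (simp add: ker_iff vectors_def)

lemma finite_ker:
  assumes "A \<subseteq> E" shows "finite (ker A)"
proof (rule finite_subset)
  show "ker A \<subseteq> {x. \<forall>i. (i \<in> A \<longrightarrow> x i \<in> UNIV) \<and> (i \<notin> A \<longrightarrow> x i = 0)}"
    by (auto simp: ker_iff vectors_def)
  show "finite {x. \<forall>i. (i \<in> A \<longrightarrow> x i \<in> (UNIV :: bit set)) \<and> (i \<notin> A \<longrightarrow> x i = 0)}"
    using assms finite_E by (intro finite_set_of_finite_funs finite_UNIV_bit) (auto intro: finite_subset)
qed

text \<open>The quadratic form of \<open>C\<close> vanishes at kernel vectors, and by
  \<open>dot_mv_self\<close> it is the linear form given by \<open>diag\<close>.\<close>

lemma ker_orthogonal_diag:
  assumes "x \<in> ker A" shows "dot x diag = 0"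
  using dot_mv_solution[of x A x "\<lambda>_. 0"] assms by (auto simp: ker_iff dot_mv_self)

text \<open>The form at \<open>y\<close> and \<open>k\<close> equals \<open>y t\<close> in one order
  and 0 in the other. Hence the kernel cannot have reasons both to shrink and to grow when
  \<open>t\<close> is added.\<close>

lemma ker_exclusive:
  assumes "t \<in> E" "k \<in> ker A" "mv k t = 1" "y \<in> ker (insert t A)"
  shows "y t = 0"
proof -
  have "dot y (mv k) = y t"
    using dot_mv_insert[of y t A k "\<lambda>_. 0"] assms by (auto simp: ker_iff)
  moreover have "dot k (mv y) = 0"
    using dot_mv_solution[of k A y "\<lambda>_. 0"] assms by (auto simp: ker_iff)
  ultimately show ?thesis using dot_mv_commute by metis
qed

lemma ker_Int: "t \<notin> A \<Longrightarrow> {x \<in> ker (insert t A). x t = 0} = {x \<in> ker A. mv x t = 0}"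
  by (auto simp: ker_iff vectors_def)

text \<open>Row \<open>t\<close> is a non-zero functional on \<open>ker A\<close>. Its zero set is
  the whole of \<open>ker (insert t A)\<close>, whose elements vanish at \<open>t\<close> by
  \<open>ker_exclusive\<close>.\<close>

lemma card_ker_down:
  assumes A: "A \<subseteq> E" and t: "t \<in> E" "t \<notin> A" and k: "k \<in> ker A" "mv k t = 1"
  shows "card (ker A) = 2 * card (ker (insert t A))"
proof -
  have "card (ker A) = 2 * card {x \<in> ker A. mv x t = 0}"
    by (rule card_eq_double_kernel[where S = "ker A" and h = "\<lambda>x. mv x t" and k = k])
      (use A k in \<open>simp_all add: finite_ker ker_add mv_add\<close>)
  also have "{x \<in> ker A. mv x t = 0} = ker (insert t A)"
    using ker_exclusive[OF t(1) k] by (auto simp flip: ker_Int[OF t(2)])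
  finally show ?thesis .
qed

text \<open>Dual to \<open>card_ker_down\<close>: the functional is now the coordinate at
  \<open>t\<close>, and \<open>ker_exclusive\<close> makes its zero set the whole of
  \<open>ker A\<close>.\<close>

lemma card_ker_up:
  assumes A: "A \<subseteq> E" and t: "t \<in> E" "t \<notin> A" and y: "y \<in> ker (insert t A)" "y t = 1"
  shows "card (ker (insert t A)) = 2 * card (ker A)"
proof -
  have "card (ker (insert t A)) = 2 * card {x \<in> ker (insert t A). x t = 0}"
    by (rule card_eq_double_kernel[where S = "ker (insert t A)" and h = "\<lambda>x. x t" and k = y])
      (use A t(1) y in \<open>simp_all add: finite_ker ker_add\<close>)
  also have "{x \<in> ker (insert t A). x t = 0} = ker A"
  proof -
    have "mv k t \<noteq> 1" if "k \<in> ker A" for k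
    proof
      assume "mv k t = 1"
      from ker_exclusive[OF t(1) that this y(1)] y(2) show False by simp
    qed
    then show ?thesis unfolding ker_Int[OF t(2)] by auto
  qed
  finally show ?thesis .
qed

lemma card_ker_same:
  assumes t: "t \<notin> A" and "\<And>k. k \<in> ker A \<Longrightarrow> mv k t \<noteq> 1" "\<And>y. y \<in> ker (insert t A) \<Longrightarrow> y t \<noteq> 1"
  shows "card (ker (insert t A)) = card (ker A)"
proof -
  have "ker (insert t A) = {x \<in> ker (insert t A). x t = 0}" "ker A = {x \<in> ker A. mv x t = 0}"
    using assms by auto
  with ker_Int[OF t] show ?thesis by metis
qed

lemma card_ker_flip:
  assumes "A \<subseteq> E" "t \<in> E"
  shows "card (ker A) \<le> 2 * card (ker (sym_diff A {t}))"
proof -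
  have *: "card (ker B) \<le> 2 * card (ker (insert t B)) \<and> card (ker (insert t B)) \<le> 2 * card (ker B)"
    if "B \<subseteq> E" "t \<notin> B" for B
  proof -
    consider k where "k \<in> ker B" "mv k t = 1" | y where "y \<in> ker (insert t B)" "y t = 1"
      | "\<forall>k\<in>ker B. mv k t \<noteq> 1" "\<forall>y\<in>ker (insert t B). y t \<noteq> 1" by blast
    then show ?thesis
      using card_ker_down[OF that(1) assms(2) that(2)] card_ker_up[OF that(1) assms(2) that(2)]
        card_ker_same[OF that(2)]
      by cases simp_all
  qed
  show ?thesis
  proof (cases "t \<in> A")
    case True
    then have "sym_diff A {t} = A - {t}" "insert t (A - {t}) = A" by auto
    then show ?thesis using *[of "A - {t}"] assms by auto
  next
    case False
    then have "sym_diff A {t} = insert t A" by auto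
    then show ?thesis using *[of A] assms False by auto
  qed
qed

section \<open>Nullity as distance to the nearest regular set\<close>

text \<open>Walk from \<open>A\<close> to \<open>F\<close> one element at a time: each step changes
  the kernel size by a factor of at most 2, and \<open>ker F\<close> has one element.\<close>

lemma card_ker_le:
  assumes "A \<subseteq> E" "F \<subseteq> E" "regular F"
  shows "card (ker A) \<le> 2 ^ card (sym_diff A F)"
  using assms(1)
proof (induction "card (sym_diff A F)" arbitrary: A)
  case 0
  have "finite (sym_diff A F)"
    by (rule finite_subset[OF _ finite_E]) (use 0(2) assms(2) in blast)
  with 0(1) have "sym_diff A F = {}" by simp
  then have "A = F" by blast
  then show ?case using assms(3) by (simp add: regular_def)
next
  case (Suc n)
  then obtain t where t: "t \<in> sym_diff A F" by (metis card.empty equals0I nat.distinct(1))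
  have fin: "finite (sym_diff A F)"
    by (rule finite_subset[OF _ finite_E]) (use Suc.prems assms(2) in blast)
  have "sym_diff (sym_diff A {t}) F = sym_diff A F - {t}" using t by blast
  then have "card (sym_diff (sym_diff A {t}) F) = n"
    using Suc.hyps(2) t fin by simp
  moreover have tE: "t \<in> E" "sym_diff A {t} \<subseteq> E" using t Suc.prems assms by blast+
  ultimately have "card (ker (sym_diff A {t})) \<le> 2 ^ n"
    using Suc.hyps(1) by metis
  with card_ker_flip[OF Suc.prems tE(1)] have "card (ker A) \<le> 2 ^ Suc n" by simp
  then show ?case unfolding Suc.hyps(2) .
qed

text \<open>Deleting an element \<open>t\<close> from the support of a kernel vector halves the
  kernel. Repeating this ends at a regular subset.\<close>

lemma card_ker_attained:
  assumes "A \<subseteq> E"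
  shows "\<exists>F\<subseteq>A. regular F \<and> card (ker A) = 2 ^ card (A - F)"
  using assms
proof (induction "card A" arbitrary: A rule: less_induct)
  case less
  show ?case
  proof (cases "regular A")
    case True
    then show ?thesis by (intro exI[of _ A]) (simp add: regular_def)
  next
    case False
    then obtain x where x: "x \<in> ker A" "x \<noteq> (\<lambda>_. 0)"
      using zero_in_ker[of A] unfolding regular_def by blast
    from x(2) obtain t where "x t \<noteq> 0" by (auto simp: fun_eq_iff)
    then have t: "x t = 1" by simp
    have tA: "t \<in> A"
    proof (rule ccontr)
      assume "t \<notin> A"
      with x(1) have "x t = 0" by (simp add: ker_iff vectors_def)
      with t show False by simp
    qed
    have finA: "finite A" using less.prems finite_E finite_subset by blast
    have "card (A - {t}) < card A" "A - {t} \<subseteq> E"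
      using card_Diff1_less[OF finA tA] less.prems by blast+
    then obtain F where F: "F \<subseteq> A - {t}" "regular F" "card (ker (A - {t})) = 2 ^ card (A - {t} - F)"
      using less.hyps by meson
    have "insert t (A - {t}) = A" using tA by auto
    then have "card (ker A) = 2 * card (ker (A - {t}))"
      using card_ker_up[of "A - {t}" t x] x(1) t tA less.prems by auto
    moreover have "A - F = insert t (A - {t} - F)" using tA F(1) by blast
    ultimately have "card (ker A) = 2 ^ card (A - F)"
      using F(3) finA by simp
    with F show ?thesis by blast
  qed
qed

lemma finite_regular: "finite {F. F \<subseteq> E \<and> regular F}"
  using finite_E by simp

lemma regular_empty: "regular {}"
  by (auto simp: regular_def ker_iff vectors_def)

lemma card_ker:
  assumes "A \<subseteq> E" shows "card (ker A) = 2 ^ nul A"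
proof -
  let ?S = "(\<lambda>F. card (sym_diff A F)) ` {F. F \<subseteq> E \<and> regular F}"
  obtain F where F: "F \<subseteq> A" "regular F" "card (ker A) = 2 ^ card (A - F)"
    using card_ker_attained[OF assms] by blast
  then have "sym_diff A F = A - F" by auto
  have "Min ?S = card (A - F)"
  proof (rule Min_eqI)
    show "finite ?S" using finite_regular by blast
    show "card (A - F) \<in> ?S" using F assms \<open>sym_diff A F = A - F\<close>
      by (intro image_eqI[of _ _ F]) auto
    show "card (A - F) \<le> m" if "m \<in> ?S" for m
      using that card_ker_le[OF assms] F(3) by (auto dest!: power_le_imp_le_exp[rotated])
  qed
  with F show ?thesis by (simp add: nul_def)
qed

text \<open>The cases carry the vectors responsible for the change of nullity, because later
  arguments pair these with solutions.\<close>

lemma nul_insert_cases: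
  assumes "A \<subseteq> E" "t \<in> E" "t \<notin> A"
  obtains k where "k \<in> ker A" "mv k t = 1" "nul A = Suc (nul (insert t A))"
  | y where "y \<in> ker (insert t A)" "y t = 1" "nul (insert t A) = Suc (nul A)"
  | "\<And>k. k \<in> ker A \<Longrightarrow> mv k t = 0" "\<And>y. y \<in> ker (insert t A) \<Longrightarrow> y t = 0" "nul (insert t A) = nul A"
proof -
  have iA: "insert t A \<subseteq> E" using assms by auto
  consider (down) k where "k \<in> ker A" "mv k t = 1" | (up) y where "y \<in> ker (insert t A)" "y t = 1"
    | (same) "\<forall>k\<in>ker A. mv k t \<noteq> 1" "\<forall>y\<in>ker (insert t A). y t \<noteq> 1" by blast
  then show thesis
  proof cases
    case down
    from card_ker_down[OF assms this] have "(2::nat) ^ nul A = 2 ^ Suc (nul (insert t A))"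
      by (simp add: card_ker[OF assms(1)] card_ker[OF iA])
    then have "nul A = Suc (nul (insert t A))" by (subst (asm) power_inject_exp) auto
    with down that(1) show thesis by blast
  next
    case up
    from card_ker_up[OF assms this] have "(2::nat) ^ nul (insert t A) = 2 ^ Suc (nul A)"
      by (simp add: card_ker[OF assms(1)] card_ker[OF iA])
    then have "nul (insert t A) = Suc (nul A)" by (subst (asm) power_inject_exp) auto
    with up that(2) show thesis by blast
  next
    case same
    with card_ker_same[OF assms(3)] have "(2::nat) ^ nul (insert t A) = 2 ^ nul A"
      by (simp add: card_ker[OF assms(1)] card_ker[OF iA])
    then have "nul (insert t A) = nul A" by (subst (asm) power_inject_exp) auto
    with same that(3) show thesis by simp
  qed
qed


section \<open>The range as the orthogonal complement of the kernel\<close>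

lemma dot_column: "t \<in> E \<Longrightarrow> dot x (\<lambda>i. C i t) = mv x t"
  unfolding dot_def mv_def using C_sym by (intro sum.cong) (auto simp: mult.commute)

text \<open>Setting coordinate \<open>t\<close> of \<open>z\<close> to 1 adds column
  \<open>t\<close> a second time, so the rows in \<open>A\<close> cancel.\<close>

lemma solves_column:
  assumes t: "t \<in> E" "t \<notin> A" and z: "solves A (\<lambda>i. C i t) z"
  obtains y where "y \<in> vectors (insert t A)" "y t = 1" "\<And>i. i \<in> A \<Longrightarrow> mv y i = 0"
proof (rule that[of "z(t := 1)"])
  have zt: "z t = 0" using z t(2) by (simp add: solves_def vectors_def)
  show "mv (z(t := 1)) i = 0" if "i \<in> A" for i
    using that z mv_upd[of t z, OF t(1) zt] by (simp add: solves_def)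
qed (use z in \<open>auto simp: solves_def vectors_def\<close>)

text \<open>Induction on \<open>A\<close>: solve the rows in \<open>A\<close> first, then repair row
  \<open>t\<close> with a vector that changes this row alone.\<close>

lemma range_ker_orthogonal:
  assumes "A \<subseteq> E" "\<And>k. k \<in> ker A \<Longrightarrow> dot k g = 0"
  shows "\<exists>x. solves A g x"
proof -
  have "finite A" using assms finite_E finite_subset by blast
  then show ?thesis using assms
  proof (induction A arbitrary: g)
    case empty
    show ?case by (intro exI[of _ "\<lambda>_. 0"]) (simp add: solves_def vectors_def)
  next
    case (insert t A)
    have t: "t \<in> E" "t \<notin> A" and A: "A \<subseteq> E" using insert by auto
    show ?case
    proof (cases "\<exists>k\<in>ker A. mv k t = 1")
      case True
      then obtain k where k: "k \<in> ker A" "mv k t = 1" by blast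
      \<comment> \<open>The multiple \<open>a\<close> of column \<open>t\<close> is chosen to make
        the new right-hand side \<open>h\<close> orthogonal to \<open>k\<close>, and thereby to all
        of \<open>ker A\<close>.\<close>
      define a where "a = dot k g"
      define h where "h i = g i + a * C i t" for i
      have dot_h: "dot x h = dot x g + a * mv x t" for x
        using dot_column[OF t(1), of x] by (cases a) (simp_all add: h_def[abs_def] dot_add_right)
      have down: "y \<in> ker (insert t A)" if "y \<in> ker A" "mv y t = 0" for y
        using that ker_Int[OF t(2)] by blast
      have "dot y h = 0" if y: "y \<in> ker A" for y
      proof (cases "mv y t")
        case zero
        with down[OF y] insert.prems(2) show ?thesis by (simp add: dot_h)
      next
        case one
        have "(\<lambda>i. y i + k i) \<in> ker (insert t A)"
          using one k(2) by (intro down ker_add y k(1)) (simp add: mv_add)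
        from insert.prems(2)[OF this] have "dot y g + dot k g = 0"
          by (simp add: dot_add)
        then show ?thesis using one by (simp add: dot_h a_def)
      qed
      then obtain x where x: "solves A h x" using insert.IH[OF A] by blast
      \<comment> \<open>Coordinate \<open>t\<close> gets the value \<open>a\<close>, which adds
        \<open>a\<close> times column \<open>t\<close> and turns \<open>h\<close> back into
        \<open>g\<close> on \<open>A\<close>.\<close>
      define x' where "x' = (if a = 1 then x(t := 1) else x)"
      have xt: "x t = 0" using x t(2) by (simp add: solves_def vectors_def)
      have mx': "mv x' i = mv x i + a * C i t" for i
        using mv_upd[of t x, OF t(1) xt] by (cases a) (auto simp: x'_def)
      have x'A: "mv x' i = g i" if "i \<in> A" for i
        using that x by (simp add: mx' solves_def h_def add.assoc)
      have x'v: "x' \<in> vectors (insert t A)"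
        using x by (auto simp: x'_def solves_def vectors_def)
      show ?thesis
      proof (cases "mv x' t = g t")
        case True
        with x'A x'v show ?thesis by (intro exI[of _ x']) (auto simp: solves_def)
      next
        case False
        \<comment> \<open>Only row \<open>t\<close> is wrong, by 1, and adding \<open>k\<close>
          changes it without touching the rows in \<open>A\<close>.\<close>
        then have "mv x' t + 1 = g t" by (cases "mv x' t"; cases "g t") simp_all
        moreover have "k \<in> vectors (insert t A)"
          using k(1) by (auto simp: ker_iff vectors_def)
        ultimately show ?thesis
          using x'A x'v k
          by (intro exI[of _ "\<lambda>i. x' i + k i"]) (auto simp: solves_def mv_add ker_iff vectors_add)
      qed
    next
      case False
      then have kt: "mv k t = 0" if "k \<in> ker A" for k using that by auto
      have up: "k \<in> ker (insert t A)" if "k \<in> ker A" for k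
        using that kt[OF that] ker_Int[OF t(2)] by blast
      obtain x where x: "solves A g x" using insert.IH[OF A] insert.prems(2) up by blast
      \<comment> \<open>Every vector of \<open>ker A\<close> is killed by row \<open>t\<close>, so
        column \<open>t\<close> is orthogonal to \<open>ker A\<close> and is itself a solvable
        right-hand side.\<close>
      have "dot k (\<lambda>i. C i t) = 0" if "k \<in> ker A" for k
        using kt[OF that] by (simp add: dot_column[OF t(1)])
      then obtain z where z: "solves A (\<lambda>i. C i t) z" using insert.IH[OF A] by blast
      obtain y where yv: "y \<in> vectors (insert t A)" and yt: "y t = 1"
        and yA: "\<And>i. i \<in> A \<Longrightarrow> mv y i = 0"
        using solves_column[OF t z] by blast
      have xv: "x \<in> vectors (insert t A)"
        using x by (auto simp: solves_def vectors_def)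
      show ?thesis
      proof (cases "mv x t = g t")
        case True
        with x xv show ?thesis by (intro exI[of _ x]) (auto simp: solves_def)
      next
        case False
        \<comment> \<open>Evaluating the form at \<open>x\<close> and \<open>y\<close> in both
          orders shows that a wrong row \<open>t\<close> forces \<open>dot y g\<close> to be 1. Then
          \<open>y\<close> is not in the kernel, so \<open>mv y t = 1\<close> and adding
          \<open>y\<close> repairs the row.\<close>
        have "dot y (mv x) = dot y g + (mv x t + g t)"
          using dot_mv_insert[OF yv t(1), of x g] x yt by (simp add: solves_def)
        moreover have "dot y (mv x) = 0"
          using dot_mv_solution[of x A y "\<lambda>_. 0"] x yA dot_mv_commute by (simp add: solves_def)
        moreover have "mv x t + g t = 1"
          using False by (cases "mv x t"; cases "g t") simp_all
        ultimately have "dot y g \<noteq> 0" by (cases "dot y g") simp_all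
        then have "y \<notin> ker (insert t A)" using insert.prems(2) by auto
        then have "mv y t = 1" using yv yA by (auto simp: ker_iff)
        moreover have "mv x t + 1 = g t" using False by (cases "mv x t"; cases "g t") simp_all
        ultimately show ?thesis using x xv yA yv
          by (intro exI[of _ "\<lambda>i. x i + y i"]) (auto simp: solves_def mv_add vectors_add)
      qed
    qed
  qed
qed

section \<open>Parity of the rank from the diagonal\<close>

lemma solves_diag_exists: "A \<subseteq> E \<Longrightarrow> \<exists>u. solves A diag u"
  using range_ker_orthogonal[of A diag] ker_orthogonal_diag by blast

text \<open>Two solutions differ by a kernel vector, which is orthogonal to \<open>diag\<close>; so
  the parity can be read off any solution.\<close>

lemma solves_diag_unique:
  assumes "solves A diag u" "solves A diag v"
  shows "dot u diag = dot v diag"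
proof -
  have "(\<lambda>i. u i + v i) \<in> ker A"
    using assms by (simp add: solves_def ker_iff vectors_add mv_add)
  from ker_orthogonal_diag[OF this] have "dot u diag + dot v diag = 0"
    by (simp add: dot_add)
  then show ?thesis by (simp add: bit_add_eq_0_iff)
qed

text \<open>The number \<open>card A + nul A\<close> has the parity of the rank \<open>card A - nul A\<close> of \<open>C[A]\<close>.\<close>

lemma rank_parity_exists:
  assumes "A \<subseteq> E"
  shows "\<exists>u. solves A diag u \<and> dot u diag = of_nat (card A + nul A)"
proof -
  have "finite A" using assms finite_E finite_subset by blast
  then show ?thesis using assms
  proof (induction A)
    case empty
    have "card (ker {}) = 1" using regular_empty by (simp add: regular_def)
    then have "nul {} = 0" using card_ker[of "{}"] by simp
    then show ?case
      by (intro exI[of _ "\<lambda>_. 0"]) (simp add: solves_def vectors_def dot_commute[of "\<lambda>_. 0"])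
  next
    case (insert t A)
    have t: "t \<in> E" "t \<notin> A" and A: "A \<subseteq> E" using insert by auto
    obtain u where u: "solves A diag u" "dot u diag = of_nat (card A + nul A)"
      using insert.IH[OF A] by blast
    obtain v where v: "solves (insert t A) diag v"
      using solves_diag_exists[OF insert.prems] by blast
    have cA: "card (insert t A) = Suc (card A)" using insert by simp
    from A t show ?case
    proof (cases rule: nul_insert_cases)
      case (1 k)
      \<comment> \<open>The rank grows by 2, so the parity must stay. Adding \<open>k\<close> if
        necessary makes the solution for \<open>A\<close> satisfy row \<open>t\<close> as
        well.\<close>
      obtain u' where u': "solves A diag u'" "mv u' t = diag t"
      proof (cases "mv u t = diag t")
        case True with u that show thesis by blast
      next
        case False
        then have "mv u t + 1 = diag t" by (cases "mv u t"; cases "diag t") simp_all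
        with u(1) 1 show thesis
          by (intro that[of "\<lambda>i. u i + k i"]) (auto simp: solves_def mv_add ker_iff vectors_add)
      qed
      then have "solves (insert t A) diag u'" by (auto simp: solves_def vectors_def)
      moreover have "dot u' diag = of_nat (card (insert t A) + nul (insert t A))"
        using solves_diag_unique[OF u(1) u'(1)] u(2) 1(3) cA by simp
      ultimately show ?thesis by blast
    next
      case (2 y)
      \<comment> \<open>The rank stays the same. Pairing \<open>u\<close> with the kernel vector
        \<open>y\<close>, which is orthogonal to \<open>diag\<close>, shows that \<open>u\<close>
        already satisfies row \<open>t\<close>.\<close>
      have ym: "mv y i = 0" if "i \<in> insert t A" for i using 2(1) that by (auto simp: ker_iff)
      have "dot y (mv u) = dot y diag + (mv u t + diag t)"
        using dot_mv_insert[of y t A u diag] 2 t u(1) by (simp add: ker_iff solves_def)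
      moreover have "dot u (mv y) = 0"
        using dot_mv_solution[of u A y "\<lambda>_. 0"] u(1) ym by (simp add: solves_def)
      ultimately have "mv u t + diag t = 0"
        using dot_mv_commute[of y u] ker_orthogonal_diag[OF 2(1)] by simp
      then have "solves (insert t A) diag u"
        using u(1) by (auto simp: solves_def vectors_def bit_add_eq_0_iff)
      moreover have "(of_nat (card (insert t A) + nul (insert t A)) :: bit) = of_nat (card A + nul A)"
        using 2(3) cA by (simp add: add.assoc[symmetric])
      ultimately show ?thesis using u(2) by metis
    next
      case 3
      \<comment> \<open>The rank grows by 1. A vector \<open>y\<close> with \<open>C y\<close> equal
        to the unit vector at \<open>t\<close> on \<open>insert t A\<close> has
        \<open>dot y diag = 1\<close>; pairing it with \<open>u\<close> shows that \<open>u\<close>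
        fails row \<open>t\<close>, so \<open>u + y\<close> is the solution and the parity
        flips.\<close>
      have "dot k (\<lambda>i. C i t) = 0" if "k \<in> ker A" for k
        using 3(1)[OF that] by (simp add: dot_column[OF t(1)])
      then obtain z where z: "solves A (\<lambda>i. C i t) z" using range_ker_orthogonal[OF A] by blast
      obtain y where yv: "y \<in> vectors (insert t A)" and yt: "y t = 1"
        and yA: "\<And>i. i \<in> A \<Longrightarrow> mv y i = 0"
        using solves_column[OF t z] by blast
      have "y \<notin> ker (insert t A)" using 3(2)[of y] yt by auto
      then have ymt: "mv y t = 1" using yv yA by (auto simp: ker_iff)
      have "dot y diag = 1"
        using dot_mv_insert[OF yv t(1), of y "\<lambda>_. 0"] yA ymt yt dot_mv_self[of y] by simp
      moreover have "dot y (mv u) = dot y diag + (mv u t + diag t)"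
        using dot_mv_insert[OF yv t(1), of u diag] u(1) yt by (simp add: solves_def)
      moreover have "dot y (mv u) = 0"
        using dot_mv_solution[of u A y "\<lambda>_. 0"] u(1) yA dot_mv_commute[of y u] by (simp add: solves_def)
      ultimately have "mv u t + 1 = diag t"
        by (cases "mv u t"; cases "diag t") simp_all
      then have "solves (insert t A) diag (\<lambda>i. u i + y i)"
        using u(1) yv yA ymt vectors_mono[OF _ subset_insertI, of u A t]
        by (auto simp: solves_def mv_add vectors_add)
      moreover have "dot (\<lambda>i. u i + y i) diag = of_nat (card (insert t A) + nul (insert t A))"
        using u(2) \<open>dot y diag = 1\<close> 3(3) cA by (simp add: dot_add add_ac)
      ultimately show ?thesis by blast
    qed
  qed
qed

lemma rank_parity:
  assumes "A \<subseteq> E" "solves A diag u"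
  shows "dot u diag = of_nat (card A + nul A)"
  using rank_parity_exists[OF assms(1)] solves_diag_unique[OF assms(2)] by metis

section \<open>Rank of the block matrix of a partition\<close>

definition wid :: "'a set \<Rightarrow> nat" where
  "wid A = card E - nul A - nul (E - A)"

lemma card_sym_diff_complement:
  assumes "A \<subseteq> E" "F \<subseteq> E"
  shows "card (sym_diff A F) + card (sym_diff (E - A) F) = card E"
proof -
  have "sym_diff (E - A) F = E - sym_diff A F" "sym_diff A F \<subseteq> E" using assms by blast+
  then show ?thesis
    using finite_E by (metis card_Diff_subset card_mono finite_subset le_add_diff_inverse)
qed

lemma nul_le: "F \<subseteq> E \<Longrightarrow> regular F \<Longrightarrow> nul A \<le> card (sym_diff A F)"
  unfolding nul_def using finite_regular by (intro Min_le) auto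

text \<open>The empty set is regular, which bounds each nullity by the size of its block; hence the
  subtractions in \<open>wid\<close> do not truncate.\<close>

lemma nul_wid:
  assumes "A \<subseteq> E" shows "nul A + nul (E - A) + wid A = card E"
proof -
  have "nul A + nul (E - A) \<le> card E"
    using card_sym_diff_complement[OF assms, of "{}"] nul_le[OF _ regular_empty, of A]
      nul_le[OF _ regular_empty, of "E - A"] by simp
  then show ?thesis by (simp add: wid_def)
qed

lemma wid_complement: "A \<subseteq> E \<Longrightarrow> wid (E - A) = wid A"
  by (simp add: wid_def double_diff diff_commute)

text \<open>\<open>wid A\<close> is the sum of the ranks of the two blocks, and
  \<open>rank_parity\<close> applies to each.\<close>

lemma wid_parity:
  assumes "A \<subseteq> E" "solves A diag u" "solves (E - A) diag v"
  shows "dot u diag + dot v diag = of_nat (wid A)"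
proof -
  have "card A + card (E - A) = card E"
    using card_sym_diff_complement[OF assms(1), of "{}"] by simp
  then have "card A + nul A + (card (E - A) + nul (E - A)) = wid A + 2 * (nul A + nul (E - A))"
    using nul_wid[OF assms(1)] by simp
  then have "(of_nat (card A + nul A + (card (E - A) + nul (E - A))) :: bit)
      = of_nat (wid A + 2 * (nul A + nul (E - A)))" by (rule arg_cong)
  also have "\<dots> = of_nat (wid A)" by simp
  finally show ?thesis
    using rank_parity[OF assms(1,2)] rank_parity[OF _ assms(3)] by simp
qed

text \<open>Each nullity rises by at most 1 when \<open>t\<close> leaves \<open>B\<close>, so a drop
  of 2 means that both rise. The conclusion about \<open>u\<close> and \<open>v\<close> says that
  they remain solutions after \<open>t\<close> has moved.\<close>

lemma wid_flip_aux:
  assumes "B \<subseteq> E" "t \<in> B"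
  shows "wid B \<le> wid (B - {t}) + 2"
    and "wid B = wid (B - {t}) + 2 \<Longrightarrow> solves B diag u \<Longrightarrow> solves (E - B) diag v \<Longrightarrow>
      u t = 0 \<and> mv u t = diag t \<and> v t = 0 \<and> mv v t = diag t"
proof -
  let ?A = "B - {t}" and ?A' = "E - B"
  have A: "?A \<subseteq> E" "t \<in> E" "t \<notin> ?A" "insert t ?A = B" using assms by auto
  have A': "?A' \<subseteq> E" "t \<notin> ?A'" "insert t ?A' = E - ?A" using assms by auto
  have eq: "nul ?A + nul (E - ?A) + wid ?A = nul B + nul ?A' + wid B"
    using nul_wid[OF A(1)] nul_wid[OF assms(1)] by simp
  have 1: "nul ?A \<le> Suc (nul B)"
    using A(1-3) by (rule nul_insert_cases) (simp_all add: insert_absorb[OF assms(2)])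
  have 2: "nul (E - ?A) \<le> Suc (nul ?A')"
    using A'(1) A(2) A'(2) by (rule nul_insert_cases) (simp_all add: A'(3))
  show "wid B \<le> wid ?A + 2" using eq 1 2 by linarith
  assume drop: "wid B = wid ?A + 2" and u: "solves B diag u" and v: "solves ?A' diag v"
  have nA: "nul ?A = Suc (nul B)" and nA': "nul (E - ?A) = Suc (nul ?A')"
    using drop eq 1 2 by linarith+
  \<comment> \<open>The two rises supply witnesses: \<open>k\<close> in the kernel that gains by
    losing \<open>t\<close>, and \<open>y\<close> in the kernel that gains by receiving
    \<open>t\<close>. Pairing \<open>k\<close> with \<open>u\<close> gives \<open>u t = 0\<close>,
    and pairing \<open>y\<close> with \<open>v\<close> gives row \<open>t\<close> for
    \<open>v\<close>.\<close>
  from A(1-3) obtain k where k: "k \<in> ker ?A" "mv k t = 1"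
    by (rule nul_insert_cases) (use nA A(4) in auto)
  from A'(1) A(2) A'(2) obtain y where y: "y \<in> ker (insert t ?A')" "y t = 1"
    by (rule nul_insert_cases) (use nA' A'(3) in auto)
  have "dot u (mv k) = u t"
    using dot_mv_insert[of u t ?A k "\<lambda>_. 0"] k u A(2,4) by (auto simp: solves_def ker_iff)
  moreover have "dot k (mv u) = 0"
    using dot_mv_solution[of k ?A u diag] k(1) u ker_orthogonal_diag[OF k(1)]
    by (auto simp: solves_def ker_iff)
  ultimately have "u t = 0" using dot_mv_commute[of u k] by simp
  moreover have "mv u t = diag t" using u assms(2) by (simp add: solves_def)
  moreover have "v t = 0" using v assms(2) by (simp add: solves_def vectors_def)
  moreover have "mv v t = diag t"
  proof -
    have "dot y (mv v) = dot y diag + (mv v t + diag t)"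
      using dot_mv_insert[of y t ?A' v diag] A(2) y v by (simp add: solves_def ker_iff)
    moreover have "dot v (mv y) = 0"
      using dot_mv_solution[of v ?A' y "\<lambda>_. 0"] v y(1) by (simp add: solves_def ker_iff)
    ultimately show ?thesis
      using dot_mv_commute[of y v] ker_orthogonal_diag[OF y(1)] by (simp add: bit_add_eq_0_iff)
  qed
  ultimately show "u t = 0 \<and> mv u t = diag t \<and> v t = 0 \<and> mv v t = diag t" by blast
qed

lemma wid_flip:
  assumes "B \<subseteq> E" "t \<in> E"
  shows "wid B \<le> wid (sym_diff B {t}) + 2"
    and "wid B = wid (sym_diff B {t}) + 2 \<Longrightarrow> solves B diag u \<Longrightarrow> solves (E - B) diag v \<Longrightarrow>
      u t = 0 \<and> mv u t = diag t \<and> v t = 0 \<and> mv v t = diag t"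
proof -
  have "wid B \<le> wid (sym_diff B {t}) + 2 \<and> (wid B = wid (sym_diff B {t}) + 2 \<longrightarrow>
    solves B diag u \<longrightarrow> solves (E - B) diag v \<longrightarrow>
      u t = 0 \<and> mv u t = diag t \<and> v t = 0 \<and> mv v t = diag t)"
  proof (cases "t \<in> B")
    case True
    then have "sym_diff B {t} = B - {t}" by blast
    with wid_flip_aux[OF assms(1) True] show ?thesis by simp
  next
    case False
    then have "E - sym_diff B {t} = E - B - {t}" "sym_diff B {t} \<subseteq> E" using assms(2) assms(1) by blast+
    then have "wid (sym_diff B {t}) = wid (E - B - {t})" using wid_complement by metis
    moreover have "wid (E - B) = wid B" "E - (E - B) = B" using wid_complement assms(1) by auto
    moreover have "t \<in> E - B" "E - B \<subseteq> E" using False assms by auto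
    \<comment> \<open>The partition is unordered: \<open>E - B\<close> takes the place of
      \<open>B\<close>, so \<open>u\<close> and \<open>v\<close> are exchanged.\<close>
    ultimately show ?thesis
      using wid_flip_aux(1)[of "E - B" t] wid_flip_aux(2)[of "E - B" t v u] by simp
  qed
  then show "wid B \<le> wid (sym_diff B {t}) + 2"
    and "wid B = wid (sym_diff B {t}) + 2 \<Longrightarrow> solves B diag u \<Longrightarrow> solves (E - B) diag v \<Longrightarrow>
      u t = 0 \<and> mv u t = diag t \<and> v t = 0 \<and> mv v t = diag t" by blast+
qed

lemma wid_interpolates:
  assumes A: "A \<subseteq> E" and A': "A' \<subseteq> E" and "wid A < k" "k < wid A'" and parity: "even (wid A) = even k"
  shows "\<exists>B\<subseteq>E. wid B = k"
proof (rule ccontr)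
  assume no: "\<not> (\<exists>B\<subseteq>E. wid B = k)"
  obtain B where B: "B \<subseteq> E" "k < wid B"
    and least: "\<And>B'. B' \<subseteq> E \<Longrightarrow> k < wid B' \<Longrightarrow> card (sym_diff A B) \<le> card (sym_diff A B')"
    using ex_has_least_nat[of "\<lambda>B. B \<subseteq> E \<and> k < wid B" A' "\<lambda>B. card (sym_diff A B)"] assms by auto
  have fin: "finite (sym_diff A B)"
    by (rule finite_subset[OF _ finite_E]) (use A B(1) in blast)
  have flip: "wid B = k + 1 \<and> wid B = wid (sym_diff B {t}) + 2" if t: "t \<in> sym_diff A B" for t
  proof -
    have tE: "t \<in> E" and sub: "sym_diff B {t} \<subseteq> E" using t A B(1) by blast+
    have "sym_diff A (sym_diff B {t}) = sym_diff A B - {t}" using t by blast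
    then have "card (sym_diff A (sym_diff B {t})) < card (sym_diff A B)"
      using card_Diff1_less[OF fin t] by metis
    then have "\<not> k < wid (sym_diff B {t})" using least[OF sub] by linarith
    moreover have "wid (sym_diff B {t}) \<noteq> k" using no sub by blast
    \<comment> \<open>The width after the step is below \<open>k\<close>, the one before it is above
      \<open>k\<close>, and they differ by at most 2.\<close>
    ultimately show ?thesis using wid_flip(1)[OF B(1) tE] B(2) by linarith
  qed
  have "A \<noteq> B" using assms(3) B(2) by auto
  then obtain t where "t \<in> sym_diff A B" by blast
  then have widB: "wid B = k + 1" using flip by blast
  obtain u where u: "solves B diag u"
    using solves_diag_exists[OF B(1)] by blast
  obtain v where v: "solves (E - B) diag v"
    using solves_diag_exists[of "E - B"] by blast
  have T: "u t = 0 \<and> mv u t = diag t \<and> v t = 0 \<and> mv v t = diag t" if t: "t \<in> sym_diff A B" for t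
  proof -
    have "t \<in> E" using t A B(1) by blast
    then show ?thesis using wid_flip(2)[OF B(1) _ _ u v] flip[OF t] by blast
  qed
  \<comment> \<open>Each condition in \<open>T\<close> concerns a single row and coordinate of the
    fixed vectors \<open>u\<close> and \<open>v\<close>, so all elements of
    \<open>sym_diff A B\<close> may be moved at once.\<close>
  have uA: "solves A diag u"
    unfolding solves_def vectors_def
  proof (intro conjI ballI CollectI allI impI)
    show "u i = 0" if "i \<notin> A" for i
      using that T[of i] u by (cases "i \<in> B") (auto simp: solves_def vectors_def)
    show "mv u i = diag i" if "i \<in> A" for i
      using that T[of i] u by (cases "i \<in> B") (auto simp: solves_def)
  qed
  have vA: "solves (E - A) diag v"
    unfolding solves_def vectors_def
  proof (intro conjI ballI CollectI allI impI)
    show "v i = 0" if "i \<notin> E - A" for i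
      using that T[of i] v by (cases "i \<in> E - B") (auto simp: solves_def vectors_def)
    show "mv v i = diag i" if "i \<in> E - A" for i
      using that T[of i] v by (cases "i \<in> B") (auto simp: solves_def)
  qed
  have "(of_nat (wid A) :: bit) = of_nat (wid B)"
    using wid_parity[OF A uA vA] wid_parity[OF B(1) u v] by simp
  then have "even (wid A) = even (wid B)"
    by (metis even_of_nat)
  then show False using widB parity by simp
qed

section \<open>From regular sets to widths of twists\<close>

lemma regular_iff_det:
  assumes "A \<subseteq> E" shows "regular A \<longleftrightarrow> det_GF2 C A \<noteq> 0"
proof -
  have mv: "(\<Sum>j\<in>A. C i j * x j) = mv x i" if "\<forall>i. i \<notin> A \<longrightarrow> x i = 0" for x i
    unfolding mv_def using assms finite_E that by (intro sum.mono_neutral_left) auto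
  have "det_GF2 C A = 0 \<longleftrightarrow> (\<exists>x. x \<in> ker A \<and> x \<noteq> (\<lambda>_. 0))"
    unfolding det_GF2_eq_0_iff[OF finite_subset[OF assms finite_E]] ker_iff vectors_def mem_Collect_eq
  proof (rule ex_cong1)
    show "(\<forall>i. i \<notin> A \<longrightarrow> x i = 0) \<and> x \<noteq> (\<lambda>_. 0) \<and> (\<forall>i\<in>A. (\<Sum>j\<in>A. C i j * x j) = 0) \<longleftrightarrow>
        ((\<forall>i. i \<notin> A \<longrightarrow> x i = 0) \<and> (\<forall>i\<in>A. mv x i = 0)) \<and> x \<noteq> (\<lambda>_. 0)" for x
    proof (cases "\<forall>i. i \<notin> A \<longrightarrow> x i = 0")
      case True
      then show ?thesis by (simp add: mv conj_commute)
    next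
      case False
      then show ?thesis by argo
    qed
  qed
  then show ?thesis
    unfolding regular_def using zero_in_ker[of A] by blast
qed

text \<open>The least size is \<open>nul A\<close> by definition. The greatest is found by
  complementation, since the distances of \<open>F\<close> from \<open>A\<close> and from
  \<open>E - A\<close> add up to \<open>card E\<close>.\<close>

lemma width_regular_twist:
  assumes "A \<subseteq> E"
  shows "width (S, sym_diff A ` {F. F \<subseteq> E \<and> regular F}) = wid A"
proof -
  let ?R = "{F. F \<subseteq> E \<and> regular F}"
  have "Max (card ` sym_diff A ` ?R) = card E - nul (E - A)"
    unfolding image_image
  proof (rule Max_eqI)
    let ?I = "\<lambda>B. (\<lambda>F. card (sym_diff B F)) ` ?R"
    show fin: "finite (?I B)" for B using finite_regular by blast
    show "m \<le> card E - nul (E - A)" if m: "m \<in> ?I A" for m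
    proof -
      obtain F where "F \<subseteq> E" "regular F" "m = card (sym_diff A F)" using m by blast
      then show ?thesis
        using card_sym_diff_complement[OF assms, of F] nul_le[of F "E - A"] by simp
    qed
    have "nul (E - A) \<in> ?I (E - A)"
      unfolding nul_def using regular_empty by (intro Min_in fin) blast
    then obtain F where F: "F \<subseteq> E" "regular F" "nul (E - A) = card (sym_diff (E - A) F)" by blast
    then have "card E - nul (E - A) = card (sym_diff A F)"
      using card_sym_diff_complement[OF assms, of F] by simp
    with F show "card E - nul (E - A) \<in> ?I A" by blast
  qed
  then show ?thesis
    by (simp add: width_def feasible_def wid_def nul_def image_image diff_commute)
qed

end

section \<open>Coefficients of the twist polynomial\<close>

text \<open>The coefficient counts subsets, so nothing cancels.\<close>

lemma coeff_twist_poly_nonzero_iff: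
  assumes "finite (ground D)"
  shows "coeff (twist_poly D) k \<noteq> 0 \<longleftrightarrow> (\<exists>A\<subseteq>ground D. width (twist D A) = k)"
proof -
  have "coeff (twist_poly D) k = (\<Sum>A\<in>Pow (ground D). if width (twist D A) = k then 1 else 0)"
    by (simp add: twist_poly_def coeff_sum)
  moreover have "\<dots> = (0::int) \<longleftrightarrow> (\<forall>A\<in>Pow (ground D). (if width (twist D A) = k then 1 else 0) = (0::int))"
    using assms by (intro sum_nonneg_eq_0_iff) auto
  ultimately show ?thesis by auto
qed

lemma sum_monom_coeff:
  assumes "\<And>i. i > n \<Longrightarrow> c i = 0"
  shows "coeff (\<Sum>i\<le>n. monom (c i) i) k = c k"
  using assms[of k] by (cases "k \<le> n") (simp_all add: coeff_sum)

lemma coeff_even_part: "coeff (even_part p) k = coeff p (2 * k)"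
  unfolding even_part_def by (rule sum_monom_coeff) (simp add: coeff_eq_0)

lemma coeff_odd_part: "coeff (odd_part p) k = coeff p (2 * k + 1)"
  unfolding odd_part_def by (rule sum_monom_coeff) (simp add: coeff_eq_0)

lemma interpolatingI:
  assumes "coeff p n \<noteq> 0"
    and "\<And>a b k. coeff p a \<noteq> 0 \<Longrightarrow> coeff p b \<noteq> 0 \<Longrightarrow> a < k \<Longrightarrow> k < b \<Longrightarrow> coeff p k \<noteq> 0"
  shows "interpolating p"
proof -
  have "\<not> has_gap p i k" for i k
    using assms(2)[of "i - 1" "i + k" i] by (auto simp: has_gap_def)
  moreover have "p \<noteq> 0" using assms(1) by auto
  ultimately show ?thesis by (simp add: interpolating_def)
qed

text \<open>Pulling the matrix back along the isomorphism makes \<open>D\<close> the twist by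
  \<open>A0\<close> of the system of regular sets on \<open>E\<close>. Twisting by \<open>A\<close>
  then amounts to twisting that system by \<open>sym_diff A A0\<close>, which runs through all
  subsets of \<open>E\<close> as \<open>A\<close> does.\<close>

lemma binary_delta_matroid_coeff_interpolates:
  fixes D :: "'a set_system"
  assumes "binary_delta_matroid D"
    and "coeff (twist_poly D) a \<noteq> 0" "coeff (twist_poly D) b \<noteq> 0"
    and "a < k" "k < b" "even a = even k"
  shows "coeff (twist_poly D) k \<noteq> 0"
proof -
  define E where "E = ground D"
  have fin: "finite E" and sub: "\<And>X. X \<in> feasible D \<Longrightarrow> X \<subseteq> E"
    using assms(1) by (auto simp: binary_delta_matroid_def delta_matroid_def set_system_def E_def)
  obtain A0 and E' :: "'a set" and C f where A0: "A0 \<subseteq> E" and sym: "symmetric_on E' C"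
    and f: "bij_betw f E E'"
    and feas: "(\<lambda>X. f ` X) ` sym_diff A0 ` feasible D = {A. A \<subseteq> E' \<and> det_GF2 C A \<noteq> 0}"
    using assms(1)
    by (auto simp: binary_delta_matroid_def iso_set_system_def twist_def DC_def ground_def feasible_def E_def)
  define C' where "C' i j = C (f i) (f j)" for i j
  interpret symmetric_bit_matrix E C'
  proof
    show "C' i j = C' j i" if "i \<in> E" "j \<in> E" for i j
      using sym bij_betwE[OF f] that by (simp add: C'_def symmetric_on_def)
  qed (rule fin)
  have regular_image: "regular Y \<longleftrightarrow> f ` Y \<subseteq> E' \<and> det_GF2 C (f ` Y) \<noteq> 0" if "Y \<subseteq> E" for Y
  proof -
    have "bij_betw f Y (f ` Y)" "f ` Y \<subseteq> E'"
      using f that by (auto simp: bij_betw_def intro: inj_on_subset)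
    then show ?thesis
      using regular_iff_det[OF that] det_GF2_image[of f Y "f ` Y" C] by (simp add: C'_def[abs_def])
  qed
  have invol: "sym_diff A0 (sym_diff A0 X) = X" for X by blast
  have feasD: "feasible D = sym_diff A0 ` {F. F \<subseteq> E \<and> regular F}" (is "_ = ?R")
  proof
    show "feasible D \<subseteq> ?R"
    proof
      fix X assume X: "X \<in> feasible D"
      have sE: "sym_diff A0 X \<subseteq> E" using sub[OF X] A0 by blast
      have "f ` sym_diff A0 X \<in> {A. A \<subseteq> E' \<and> det_GF2 C A \<noteq> 0}"
        unfolding feas[symmetric] using X by (intro imageI)
      then have "regular (sym_diff A0 X)" using regular_image[OF sE] by simp
      with sE show "X \<in> ?R" by (intro image_eqI[of _ _ "sym_diff A0 X"]) (simp_all only: invol mem_Collect_eq simp_thms)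
    qed
    show "?R \<subseteq> feasible D"
    proof
      fix X assume "X \<in> ?R"
      then obtain F where F: "F \<subseteq> E" "regular F" "X = sym_diff A0 F" by blast
      then have "f ` F \<in> (\<lambda>X. f ` X) ` sym_diff A0 ` feasible D"
        unfolding feas using regular_image by blast
      then obtain Y where Y: "Y \<in> feasible D" "f ` F = f ` sym_diff A0 Y" by blast
      have "sym_diff A0 Y \<subseteq> E" using sub[OF Y(1)] A0 by blast
      then have "F = sym_diff A0 Y"
        using Y(2) F(1) f inj_on_image_eq_iff[of f E F "sym_diff A0 Y"] by (simp add: bij_betw_def)
      then have "X = Y" using F(3) invol by simp
      with Y show "X \<in> feasible D" by simp
    qed
  qed
  have width: "width (twist D A) = wid (sym_diff A A0)" if "A \<subseteq> E" for A
  proof -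
    have "sym_diff A (sym_diff A0 F) = sym_diff (sym_diff A A0) F" for F by blast
    then have "sym_diff A ` feasible D = sym_diff (sym_diff A A0) ` {F. F \<subseteq> E \<and> regular F}"
      unfolding feasD image_image by (rule image_cong[OF refl])
    moreover have "sym_diff A A0 \<subseteq> E" using that A0 by blast
    ultimately show ?thesis using width_regular_twist by (simp add: twist_def)
  qed
  have coeff: "coeff (twist_poly D) n \<noteq> 0 \<longleftrightarrow> (\<exists>B\<subseteq>E. wid B = n)" for n
  proof
    assume "coeff (twist_poly D) n \<noteq> 0"
    then obtain A where A: "A \<subseteq> E" "width (twist D A) = n"
      using coeff_twist_poly_nonzero_iff[of D n] fin unfolding E_def by blast
    moreover have "sym_diff A A0 \<subseteq> E" using A A0 by blast
    ultimately show "\<exists>B\<subseteq>E. wid B = n" using width by metis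
  next
    assume "\<exists>B\<subseteq>E. wid B = n"
    then obtain B where B: "B \<subseteq> E" "wid B = n" by blast
    have "sym_diff B A0 \<subseteq> E" "sym_diff (sym_diff B A0) A0 = B" using B A0 by blast+
    with B width have "\<exists>A\<subseteq>E. width (twist D A) = n" by metis
    then show "coeff (twist_poly D) n \<noteq> 0"
      using coeff_twist_poly_nonzero_iff[of D n] fin unfolding E_def by blast
  qed
  show ?thesis
    using assms(2-) wid_interpolates unfolding coeff by metis
qed

theorem theorem1:
  fixes D :: "'a set_system"
  assumes "binary_delta_matroid D"
  shows "even_poly (twist_poly D) \<or> odd_poly (twist_poly D) \<or>
         (even_interpolating (twist_poly D) \<and> odd_interpolating (twist_poly D))"
proof (cases "even_poly (twist_poly D) \<or> odd_poly (twist_poly D)")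
  case False
  \<comment> \<open>An odd and an even degree both occur, so neither part of the polynomial is
    zero.\<close>
  then obtain m n where m: "coeff (twist_poly D) m \<noteq> 0" "odd m"
    and n: "coeff (twist_poly D) n \<noteq> 0" "even n"
    by (auto simp: even_poly_def odd_poly_def)
  note interpolates = binary_delta_matroid_coeff_interpolates[OF assms]
  have "even_interpolating (twist_poly D)"
    unfolding even_interpolating_def
  proof (rule interpolatingI)
    show "coeff (even_part (twist_poly D)) (n div 2) \<noteq> 0"
      using n by (simp add: coeff_even_part)
    show "coeff (even_part (twist_poly D)) k \<noteq> 0"
      if "coeff (even_part (twist_poly D)) a \<noteq> 0" "coeff (even_part (twist_poly D)) b \<noteq> 0"
        "a < k" "k < b" for a b k
      using that interpolates[of "2 * a" "2 * b" "2 * k"] by (simp add: coeff_even_part)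
  qed
  moreover have "odd_interpolating (twist_poly D)"
    unfolding odd_interpolating_def
  proof (rule interpolatingI)
    show "coeff (odd_part (twist_poly D)) (m div 2) \<noteq> 0"
      using m by (simp add: coeff_odd_part)
    show "coeff (odd_part (twist_poly D)) k \<noteq> 0"
      if "coeff (odd_part (twist_poly D)) a \<noteq> 0" "coeff (odd_part (twist_poly D)) b \<noteq> 0"
        "a < k" "k < b" for a b k
      using that interpolates[of "2 * a + 1" "2 * b + 1" "2 * k + 1"] by (simp add: coeff_odd_part)
  qed
  ultimately show ?thesis by blast
qed blast

end
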